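(* Let $\Gamma=G(\mathbb{Z}_n,\mathcal{C})$ be a connected oriented circulant graph with even order $n$. There is zero transfer between the antipodal vertex $n/2$ and the vertex $0$ if and only if for every distinct eigenvalue $\theta_i$ of $\Gamma$, the corresponding index set $M_{\theta_i}=\{j\in\mathbb{Z}_n:\mu_j=\theta_i\}$ contains the same number of even and odd integers.
   Context: For $\mathcal{C}\subseteq\mathbb{Z}_n\setminus\{0\}$, the circulant graph $G(\mathbb{Z}_n,\mathcal{C})$ has vertex set $\mathbb{Z}_n$ and arc set $\{(a,b): b-a\in\mathcal{C},\ a,b\in\mathbb{Z}_n\}$; it is an oriented circulant graph if $\mathcal{C}\cap\mathcal{C}^{-1}=\emptyset$, where $\mathcal{C}^{-1}=\{-c: c\in\mathcal{C}\}$. Connected means that the underlying undirected graph is connected. Its Hermitian adjacency matrix $H$ has $H_{a,b}=\mathrm{i}$ if $b-a\in\mathcal{C}$, $H_{a,b}=-\mathrm{i}$ if $a-b\in\mathcal{C}$, and $H_{a,b}=0$ otherwise, where $\mathrm{i}=\sqrt{-1}$; the eigenvalues of $\Gamma$ are those of $H$. With $\omega_n=\exp(2\pi\mathrm{i}/n)$, the eigenvalues of $H$, listed with multiplicity, are $\mu_j=\mathrm{i}\sum_{k\in\mathcal{C}}(\omega_n^{jk}-\omega_n^{-jk})=-2\sum_{k\in\mathcal{C}}\sin(2\pi jk/n)$ for $j=0,1,\ldots,n-1$, with eigenvectors $(1,\omega_n^j,\ldots,\omega_n^{(n-1)j})^\top$. The transition matrix is $U(t)=\exp(-\mathrm{i}tH)$,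 $t\in\mathbb{R}$. There is zero transfer between vertices $u$ and $v$ if $U(t)_{u,v}=0$ for all $t\ge 0$ (this condition is symmetric in $u$ and $v$). *)

theory Defs
  imports Complex_Main "Jordan_Normal_Form.Char_Poly" "Graph_Theory.Graph_Theory"
begin

(* The elements of Z_n are represented by their canonical representatives 0, ..., n - 1.
   This is a - b in Z_n, for a, b < n; n - b is not a truncated subtraction then. *)
definition zdiff :: "nat \<Rightarrow> nat \<Rightarrow> nat \<Rightarrow> nat" where
  "zdiff n a b = (a + (n - b)) mod n"

definition zneg_set :: "nat \<Rightarrow> nat set \<Rightarrow> nat set" where
  "zneg_set n C = (\<lambda>c. zdiff n 0 c) ` C"

definition circulant_graph :: "nat \<Rightarrow> nat set \<Rightarrow> nat pair_pre_digraph" where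
  "circulant_graph n C =
     \<lparr> pverts = {0..<n}, parcs = {(a, b). a < n \<and> b < n \<and> zdiff n b a \<in> C} \<rparr>"

definition oriented_connection_set :: "nat \<Rightarrow> nat set \<Rightarrow> bool" where
  "oriented_connection_set n C \<longleftrightarrow> C \<subseteq> {0..<n} - {0} \<and> C \<inter> zneg_set n C = {}"

definition hermitian_adj :: "nat \<Rightarrow> nat set \<Rightarrow> complex mat" where
  "hermitian_adj n C = mat n n (\<lambda>(a, b).
     if zdiff n b a \<in> C then \<i> else if zdiff n a b \<in> C then - \<i> else 0)"

(* Matrices with a dimension given by a term are not in the type classes required by exp,
   so the exponential series is taken entrywise; it converges for every square matrix. *)
definition mat_exp :: "complex mat \<Rightarrow> complex mat" where
  "mat_exp A = mat (dim_row A) (dim_row A)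
     (\<lambda>(a, b). \<Sum>k. (A ^\<^sub>m k) $$ (a, b) / fact k)"

definition transition_matrix :: "nat \<Rightarrow> nat set \<Rightarrow> real \<Rightarrow> complex mat" where
  "transition_matrix n C t = mat_exp ((- \<i> * complex_of_real t) \<cdot>\<^sub>m hermitian_adj n C)"

definition zero_transfer :: "nat \<Rightarrow> nat set \<Rightarrow> nat \<Rightarrow> nat \<Rightarrow> bool" where
  "zero_transfer n C u v \<longleftrightarrow> (\<forall>t::real. t \<ge> 0 \<longrightarrow> transition_matrix n C t $$ (u, v) = 0)"

definition omega :: "nat \<Rightarrow> complex" where
  "omega n = exp (2 * of_real pi * \<i> / of_nat n)"

definition mu :: "nat \<Rightarrow> nat set \<Rightarrow> nat \<Rightarrow> complex" where
  "mu n C j = \<i> * (\<Sum>k\<in>C. omega n powi int (j * k) - omega n powi (- int (j * k)))"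

definition index_set :: "nat \<Rightarrow> nat set \<Rightarrow> complex \<Rightarrow> nat set" where
  "index_set n C \<theta> = {j \<in> {0..<n}. mu n C j = \<theta>}"

end

theory Submission
  imports Defs "HOL-Complex_Analysis.Cauchy_Integral_Formula"
begin

text \<open>The Fourier vectors diagonalise the Hermitian adjacency matrix, so \<open>n * U(t)\<close> has the entry
  \<open>(\<Sum>j<n. (-1)^j * exp(-i t \<mu>\<^sub>j))\<close> at \<open>(n/2, 0)\<close>. By uniqueness of power series coefficients this
  vanishes for all \<open>t \<ge> 0\<close> iff all signed moments \<open>(\<Sum>j<n. (-1)^j * \<mu>\<^sub>j ^ k)\<close> vanish. Testing with a
  polynomial that vanishes at all eigenvalues but one turns this into the vanishing of the signed
  count of each index set.\<close>

section \<open>Powers of a primitive root of unity\<close>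

lemma omega_power: "omega n ^ j = exp (2 * of_real pi * \<i> * of_nat j / of_nat n)"
  by (simp add: omega_def exp_of_nat_mult [symmetric] algebra_simps)

lemma omega_power_eq_1_iff: "n > 0 \<Longrightarrow> omega n ^ j = 1 \<longleftrightarrow> n dvd j"
  by (simp add: omega_power complex_root_unity_eq_1)

lemma omega_nonzero [simp]: "omega n \<noteq> 0"
  by (simp add: omega_def)

lemma omega_half_power:
  assumes "n > 0" "even n"
  shows "omega n ^ (n div 2) = -1"
proof -
  have "omega n ^ (n div 2) \<noteq> 1"
    using assms by (auto simp: omega_power_eq_1_iff elim!: evenE dest!: dvd_imp_le)
  moreover have "(omega n ^ (n div 2))\<^sup>2 = 1"
    using assms by (simp add: omega_power_eq_1_iff flip: power_mult)
  ultimately show ?thesis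
    by (simp add: power2_eq_1_iff)
qed

text \<open>A geometric sum whose ratio \<open>omega n ^ a\<close> differs from 1 for
  \<open>0 < a < n\<close> and has n-th power 1. Read as a statement about vectors indexed by
  \<open>a\<close>, it writes the unit vector at vertex 0 as the average of the Fourier
  vectors.\<close>

lemma sum_omega_powers:
  assumes "a < n"
  shows "(\<Sum>j<n. omega n ^ (j * a)) = (if a = 0 then of_nat n else 0)"
proof (cases "a = 0")
  case False
  have "omega n ^ a \<noteq> 1"
    using assms False by (auto simp: omega_power_eq_1_iff dest: dvd_imp_le)
  moreover have "(omega n ^ a) ^ n = 1"
    using assms by (simp add: omega_power_eq_1_iff flip: power_mult)
  ultimately have "(\<Sum>j<n. (omega n ^ a) ^ j) = 0"
    by (simp add: geometric_sum)
  then show ?thesis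
    using False by (simp add: power_mult [symmetric] mult.commute)
qed simp

section \<open>Subtraction in Z_n on canonical representatives\<close>

lemma zdiff_less [simp]: "n > 0 \<Longrightarrow> zdiff n a b < n"
  by (simp add: zdiff_def)

lemma zdiff_eq:
  assumes "a < n" "b < n"
  shows "zdiff n a b = (if b \<le> a then a - b else a + n - b)"
proof (cases "b \<le> a")
  case True
  then have "a + (n - b) = (a - b) + n"
    using assms by simp
  then have "zdiff n a b = (a - b) mod n"
    by (simp only: zdiff_def mod_add_self2)
  then show ?thesis
    using True assms by simp
qed (use assms in \<open>simp add: zdiff_def\<close>)

lemma zdiff_involution: "a < n \<Longrightarrow> b < n \<Longrightarrow> zdiff n a (zdiff n a b) = b"
  by (cases "b \<le> a") (auto simp: zdiff_eq)

lemma zdiff_neg: "a < n \<Longrightarrow> b < n \<Longrightarrow> zdiff n 0 (zdiff n a b) = zdiff n b a"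
  by (cases a b rule: linorder_cases) (auto simp: zdiff_eq)

lemma bij_betw_zdiff_right: "a < n \<Longrightarrow> bij_betw (zdiff n a) {..<n} {..<n}"
  by (rule bij_betw_byWitness [where f' = "zdiff n a"]) (auto simp: zdiff_involution)

text \<open>\<open>b - a\<close> is the negative of \<open>a - b\<close>, so the map is a
  composition of two involutions of the previous kind.\<close>

lemma bij_betw_zdiff_left:
  assumes "a < n"
  shows "bij_betw (\<lambda>b. zdiff n b a) {..<n} {..<n}"
proof -
  have "bij_betw (zdiff n 0 \<circ> zdiff n a) {..<n} {..<n}"
    using assms by (intro bij_betw_trans [OF bij_betw_zdiff_right bij_betw_zdiff_right]) auto
  then show ?thesis
    using assms by (subst bij_betw_cong [where g = "zdiff n 0 \<circ> zdiff n a"]) (auto simp: zdiff_neg)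
qed

lemma root_of_unity_power_zdiff:
  fixes w :: complex
  assumes "w ^ n = 1" "a < n" "b < n"
  shows "w ^ zdiff n a b = w ^ a / w ^ b"
proof -
  have "w \<noteq> 0"
    using assms by (auto simp: power_0_left)
  have "w ^ m = w ^ (n * (m div n) + m mod n)" for m
    by simp
  then have "w ^ m = w ^ (m mod n)" for m
    using assms(1) by (simp only: power_add power_mult power_one mult_1_left)
  then have "w ^ (a + (n - b)) = w ^ ((a + (n - b)) mod n)" .
  \<comment> \<open>Since \<open>b < n\<close>, the exponents \<open>n - b\<close> and
    \<open>b\<close> add up to \<open>n\<close>, and \<open>w ^ n = 1\<close>.\<close>
  moreover have "w ^ (a + (n - b)) * w ^ b = w ^ a"
    using assms by (simp flip: power_add) (simp add: power_add)
  ultimately show ?thesis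
    using \<open>w \<noteq> 0\<close> by (simp add: zdiff_def field_simps)
qed

section \<open>Fourier vectors as eigenvectors\<close>

lemma mu_altdef: "mu n C j = \<i> * ((\<Sum>k\<in>C. omega n ^ (j * k)) - (\<Sum>k\<in>C. 1 / omega n ^ (j * k)))"
  unfolding mu_def
  by (simp add: sum_subtractf power_int_minus divide_inverse del: of_nat_mult)

text \<open>Substituting \<open>k = b - a\<close> for arcs leaving \<open>a\<close> and
  \<open>k = a - b\<close> for arcs entering it turns both sums over vertices into sums over
  \<open>C\<close>, with a common factor \<open>w ^ a\<close>.\<close>

lemma hermitian_adj_fourier:
  assumes "oriented_connection_set n C" "a < n"
  shows "(\<Sum>b<n. hermitian_adj n C $$ (a, b) * omega n ^ (j * b)) = mu n C j * omega n ^ (j * a)"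
proof -
  define w where "w = omega n ^ j"
  have w: "w ^ n = 1" "w \<noteq> 0"
    using assms by (auto simp: w_def omega_power_eq_1_iff simp flip: power_mult)
  have C: "C \<subseteq> {..<n}" "C \<inter> zneg_set n C = {}"
    using assms by (auto simp: oriented_connection_set_def)
  \<comment> \<open>The nested conditional becomes a difference of two indicators because
    \<open>C\<close> is disjoint from its negative: the two conditions never hold together.\<close>
  have entry: "hermitian_adj n C $$ (a, b) =
      \<i> * ((if zdiff n b a \<in> C then 1 else 0) - (if zdiff n a b \<in> C then 1 else 0))" if "b < n" for b
  proof -
    have "zdiff n b a \<in> zneg_set n C" if "zdiff n a b \<in> C"
      using that zdiff_neg [of a n b] \<open>b < n\<close> assms(2) unfolding zneg_set_def by force
    then show ?thesis
      using that assms(2) C by (auto simp: hermitian_adj_def)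
  qed
  have restrict: "(\<Sum>k<n. if k \<in> C then g k else 0) = (\<Sum>k\<in>C. g k)" for g :: "nat \<Rightarrow> complex"
    using C by (subst sum.inter_restrict [symmetric]) (auto intro: sum.cong)
  have out_arcs: "(\<Sum>b<n. if zdiff n b a \<in> C then w ^ b else 0) = (\<Sum>k\<in>C. w ^ k) * w ^ a"
  proof -
    have "(\<Sum>b<n. if zdiff n b a \<in> C then w ^ b else 0) =
        (\<Sum>b<n. if zdiff n b a \<in> C then w ^ zdiff n b a * w ^ a else 0)"
      using w assms(2) by (intro sum.cong) (auto simp: root_of_unity_power_zdiff)
    also have "\<dots> = (\<Sum>k<n. if k \<in> C then w ^ k * w ^ a else 0)"
      by (rule sum.reindex_bij_betw [OF bij_betw_zdiff_left [OF assms(2)]])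
    finally show ?thesis
      by (simp add: restrict sum_distrib_right)
  qed
  have in_arcs: "(\<Sum>b<n. if zdiff n a b \<in> C then w ^ b else 0) = (\<Sum>k\<in>C. 1 / w ^ k) * w ^ a"
  proof -
    have "(\<Sum>b<n. if zdiff n a b \<in> C then w ^ b else 0) =
        (\<Sum>b<n. if zdiff n a b \<in> C then 1 / w ^ zdiff n a b * w ^ a else 0)"
      using w assms(2) by (intro sum.cong) (auto simp: root_of_unity_power_zdiff)
    also have "\<dots> = (\<Sum>k<n. if k \<in> C then 1 / w ^ k * w ^ a else 0)"
      by (rule sum.reindex_bij_betw [OF bij_betw_zdiff_right [OF assms(2)]])
    finally show ?thesis
      by (simp only: restrict sum_distrib_right)
  qed
  have "(\<Sum>b<n. hermitian_adj n C $$ (a, b) * w ^ b) =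
      (\<Sum>b<n. \<i> * ((if zdiff n b a \<in> C then w ^ b else 0) - (if zdiff n a b \<in> C then w ^ b else 0)))"
    by (intro sum.cong) (auto simp: entry)
  also have "\<dots> = \<i> * ((\<Sum>k\<in>C. w ^ k) * w ^ a - (\<Sum>k\<in>C. 1 / w ^ k) * w ^ a)"
    by (simp only: out_arcs in_arcs sum_subtractf flip: sum_distrib_left)
  moreover have "omega n ^ (j * k) = w ^ k" for k
    by (simp add: w_def power_mult)
  ultimately show ?thesis
    by (simp add: mu_altdef algebra_simps)
qed

text \<open>The Fourier vector is nonzero because its entry at 0 is 1. This lets a hypothesis about
  eigenvalues be applied to each \<open>mu n C j\<close>.\<close>

lemma eigenvalue_mu:
  assumes "n > 0" "oriented_connection_set n C"
  shows "eigenvalue (hermitian_adj n C) (mu n C j)"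
proof -
  define H where "H = hermitian_adj n C"
  define v where "v = Matrix.vec n (\<lambda>b. omega n ^ (j * b))"
  have dim: "dim_row H = n" "dim_col H = n"
    by (simp_all add: H_def hermitian_adj_def)
  have "v \<noteq> 0\<^sub>v n"
  proof
    assume "v = 0\<^sub>v n"
    then have "vec_index v 0 = vec_index (0\<^sub>v n) 0"
      by simp
    then show False
      using assms(1) by (simp add: v_def)
  qed
  moreover have "H *\<^sub>v v = mu n C j \<cdot>\<^sub>v v"
  proof (rule eq_vecI)
    fix a assume "a < dim_vec (mu n C j \<cdot>\<^sub>v v)"
    then have "a < n"
      by (simp add: v_def)
    then show "vec_index (H *\<^sub>v v) a = vec_index (mu n C j \<cdot>\<^sub>v v) a"
      using hermitian_adj_fourier [OF assms(2) \<open>a < n\<close>, of j]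
      by (simp add: v_def dim scalar_prod_def lessThan_atLeast0 flip: H_def)
  qed (simp add: v_def dim)
  ultimately have "eigenvector H v (mu n C j)"
    by (simp add: eigenvector_def dim v_def)
  then show ?thesis
    by (auto simp: eigenvalue_def H_def)
qed

section \<open>Matrix powers and the transition matrix\<close>

lemma pow_mat_Suc_left:
  fixes A :: "'a :: semiring_1 mat"
  assumes "A \<in> carrier_mat n n"
  shows "A ^\<^sub>m Suc k = A * A ^\<^sub>m k"
  using assms by (induction k) (auto simp: assoc_mult_mat [OF assms pow_carrier_mat [OF assms] assms])

text \<open>Column 0 of the zeroth power is the average of the Fourier vectors, and each further
  factor scales the j-th of them by \<open>c * mu n C j\<close>. The scalar \<open>c\<close> later
  becomes \<open>- \<i> * t\<close>.\<close>

lemma hermitian_adj_power_column_0: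
  assumes "oriented_connection_set n C" "a < n"
  shows "((c \<cdot>\<^sub>m hermitian_adj n C) ^\<^sub>m k) $$ (a, 0) =
    (\<Sum>j<n. (c * mu n C j) ^ k * omega n ^ (j * a)) / of_nat n"
  using assms(2)
proof (induction k arbitrary: a)
  case 0
  then show ?case
    by (simp add: sum_omega_powers hermitian_adj_def)
next
  case (Suc k)
  define H where "H = hermitian_adj n C"
  have H: "H \<in> carrier_mat n n"
    by (simp add: H_def hermitian_adj_def)
  have cH: "c \<cdot>\<^sub>m H \<in> carrier_mat n n" "(c \<cdot>\<^sub>m H) ^\<^sub>m k \<in> carrier_mat n n"
    using H by (auto intro: pow_carrier_mat)
  \<comment> \<open>Peeling the new factor off on the left makes it act on column 0 of the k-th
    power, which the induction hypothesis describes.\<close>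
  have "((c \<cdot>\<^sub>m H) ^\<^sub>m Suc k) $$ (a, 0) = (\<Sum>b<n. c * H $$ (a, b) * ((c \<cdot>\<^sub>m H) ^\<^sub>m k) $$ (b, 0))"
    unfolding pow_mat_Suc_left [OF cH(1)]
    using Suc.prems H cH by (simp add: scalar_prod_def lessThan_atLeast0)
  also have "\<dots> = (\<Sum>b<n. c * H $$ (a, b) *
      ((\<Sum>j<n. (c * mu n C j) ^ k * omega n ^ (j * b)) / of_nat n))"
    by (intro sum.cong refl) (simp add: H_def Suc.IH)
  also have "\<dots> = (\<Sum>b<n. \<Sum>j<n. c * (c * mu n C j) ^ k * (H $$ (a, b) * omega n ^ (j * b))) / of_nat n"
    by (simp add: sum_distrib_left sum_divide_distrib mult_ac)
  also have "\<dots> = (\<Sum>j<n. c * (c * mu n C j) ^ k * (\<Sum>b<n. H $$ (a, b) * omega n ^ (j * b))) / of_nat n"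
    by (subst sum.swap) (simp add: sum_distrib_left)
  also have "\<dots> = (\<Sum>j<n. (c * mu n C j) ^ Suc k * omega n ^ (j * a)) / of_nat n"
    unfolding H_def hermitian_adj_fourier [OF assms(1) Suc.prems] by (simp add: mult_ac)
  finally show ?case
    by (simp add: H_def)
qed

text \<open>At row \<open>n div 2\<close> the Fourier factors reduce to signs, and for each
  \<open>j\<close> the series over \<open>k\<close> is a scalar exponential series. The sum over
  \<open>j\<close> is finite, so the limits may be taken termwise.\<close>

lemma transition_matrix_antipodal:
  assumes "n > 0" "even n" "oriented_connection_set n C"
  shows "transition_matrix n C t $$ (n div 2, 0) =
    (\<Sum>j<n. (-1) ^ j * exp (- \<i> * mu n C j * of_real t)) / of_nat n"
proof -
  have half: "n div 2 < n"
    using assms by simp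
  have omega: "omega n ^ (j * (n div 2)) = (-1) ^ j" for j
    using omega_half_power [OF assms(1,2)] by (metis mult.commute power_mult)
  have "(\<lambda>k. \<Sum>j<n. (-1) ^ j * ((- \<i> * mu n C j * of_real t) ^ k /\<^sub>R fact k)) sums
      (\<Sum>j<n. (-1) ^ j * exp (- \<i> * mu n C j * of_real t))"
    by (intro sums_sum sums_mult exp_converges)
  then have "(\<lambda>k. (\<Sum>j<n. (-1) ^ j * ((- \<i> * mu n C j * of_real t) ^ k /\<^sub>R fact k)) / of_nat n) sums
      ((\<Sum>j<n. (-1) ^ j * exp (- \<i> * mu n C j * of_real t)) / of_nat n)"
    by (rule sums_divide)
  also have "(\<lambda>k. (\<Sum>j<n. (-1) ^ j * ((- \<i> * mu n C j * of_real t) ^ k /\<^sub>R fact k)) / of_nat n) =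
      (\<lambda>k. (((- \<i> * of_real t) \<cdot>\<^sub>m hermitian_adj n C) ^\<^sub>m k) $$ (n div 2, 0) / fact k)"
    unfolding hermitian_adj_power_column_0 [OF assms(3) half] omega
    by (rule ext) (simp add: sum_divide_distrib scaleR_conv_of_real field_simps)
  finally show ?thesis
    using assms half
    by (simp add: transition_matrix_def mat_exp_def sums_iff hermitian_adj_def)
qed

section \<open>From vanishing exponential sums to vanishing fibre sums\<close>

lemma exp_sum_eq_0_imp_moments_eq_0:
  fixes c m :: "'a \<Rightarrow> complex"
  assumes "\<And>t::real. t \<ge> 0 \<Longrightarrow> (\<Sum>j\<in>S. c j * exp (m j * of_real t)) = 0"
  shows "(\<Sum>j\<in>S. c j * m j ^ k) = 0"
\<comment> \<open>The moment of order 0 is the value at \<open>t = 0\<close>; the argument by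
  isolated zeros needs a nonzero coefficient of positive order.\<close>
proof (cases "k = 0")
  case True
  then show ?thesis
    using assms [of 0] by simp
next
  case False
  \<comment> \<open>Up to the factor \<open>fact k\<close>, the moments are the Taylor coefficients
    at 0 of the entire function \<open>f\<close> that extends the exponential sum.\<close>
  define a where "a k = (\<Sum>j\<in>S. c j * m j ^ k) / fact k" for k
  define f where "f z = (\<Sum>j\<in>S. c j * exp (m j * z))" for z
  have f0: "f (of_real t) = 0" if "t \<ge> 0" for t
    using assms that by (simp add: f_def)
  have sums: "(\<lambda>k. a k * (z - 0) ^ k) sums f z" for z
  proof -
    have "(\<lambda>k. \<Sum>j\<in>S. c j * ((m j * z) ^ k /\<^sub>R fact k)) sums f z"
      unfolding f_def by (intro sums_sum sums_mult exp_converges)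
    also have "(\<lambda>k. \<Sum>j\<in>S. c j * ((m j * z) ^ k /\<^sub>R fact k)) = (\<lambda>k. a k * (z - 0) ^ k)"
      unfolding a_def sum_divide_distrib sum_distrib_right
      by (intro ext sum.cong refl) (simp add: scaleR_conv_of_real power_mult_distrib field_simps)
    finally show ?thesis .
  qed
  have "a k = 0"
  proof (rule ccontr)
    assume "a k \<noteq> 0"
    moreover have "f 0 = 0"
      using f0 [of 0] by simp
    \<comment> \<open>A nonzero coefficient would make 0 an isolated zero of \<open>f\<close>, but
      \<open>f\<close> vanishes at the positive real \<open>s\<close> on the boundary of the
      disc.\<close>
    ultimately obtain s where "0 < s" and s: "\<And>z. z \<in> cball 0 s - {0} \<Longrightarrow> f z \<noteq> 0"
      using False sums by (auto elim!: powser_0_nonzero [where r = 1 and \<xi> = 0 and m = k and f = f, rotated 3])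
    with s [of "of_real s"] f0 [of s] show False
      by simp
  qed
  then show ?thesis
    by (simp add: a_def)
qed

text \<open>By linearity the weighted sum of every polynomial in \<open>m j\<close> vanishes.
  Testing with a polynomial that is zero at all values other than \<open>\<theta>\<close> isolates
  one fibre.\<close>

lemma moments_eq_0_imp_fibre_sums_eq_0:
  fixes c m :: "'a \<Rightarrow> 'b :: idom"
  assumes "finite S" and moments: "\<And>k. (\<Sum>j\<in>S. c j * m j ^ k) = 0"
  shows "(\<Sum>j | j \<in> S \<and> m j = \<theta>. c j) = 0"
proof -
  \<comment> \<open>\<open>\<theta>\<close> need not be a value of \<open>m\<close>: in either case
    \<open>p\<close> has no root there, so \<open>poly p \<theta>\<close> can be cancelled at the
    end.\<close>
  define p where "p = (\<Prod>\<nu>\<in>m ` S - {\<theta>}. [:- \<nu>, 1:])"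
  have "(\<Sum>j\<in>S. c j * poly p (m j)) = (\<Sum>j\<in>S. \<Sum>i\<le>degree p. coeff p i * (c j * m j ^ i))"
    by (simp add: poly_altdef sum_distrib_left mult_ac)
  also have "\<dots> = (\<Sum>i\<le>degree p. coeff p i * (\<Sum>j\<in>S. c j * m j ^ i))"
    by (subst sum.swap) (simp add: sum_distrib_left)
  finally have "(\<Sum>j\<in>S. c j * poly p (m j)) = 0"
    by (simp add: moments)
  moreover have "poly p (m j) = 0" if "j \<in> S" "m j \<noteq> \<theta>" for j
    unfolding p_def poly_prod using assms(1) that by (intro prod_zero) auto
  then have "(\<Sum>j\<in>S. c j * poly p (m j)) = (\<Sum>j | j \<in> S \<and> m j = \<theta>. c j * poly p \<theta>)"
    using assms(1) by (intro sum.mono_neutral_cong_right) auto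
  ultimately have "(\<Sum>j | j \<in> S \<and> m j = \<theta>. c j) * poly p \<theta> = 0"
    by (simp add: sum_distrib_right)
  moreover have "poly p \<theta> \<noteq> 0"
    using assms(1) by (auto simp: p_def poly_prod)
  ultimately show ?thesis
    by simp
qed

section \<open>Parity counts and zero transfer\<close>

lemma sum_minus_one_powers:
  assumes "finite A"
  shows "(\<Sum>j\<in>A. (-1) ^ j :: 'a :: ring_1) =
    of_nat (card {j \<in> A. even j}) - of_nat (card {j \<in> A. odd j})"
proof -
  have "(\<Sum>j\<in>A. (-1) ^ j :: 'a) = (\<Sum>j\<in>A. (if even j then 1 else 0) - (if odd j then 1 else 0))"
    by (intro sum.cong) (auto simp: minus_one_power_iff)
  then show ?thesis
    using assms by (simp add: sum_subtractf flip: sum.inter_filter)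
qed

theorem theorem4p3:
  fixes n :: nat and C :: "nat set"
  assumes "n > 0" and "even n"
    and "oriented_connection_set n C"
    and "Digraph_Component.connected (with_proj (circulant_graph n C))"
  shows "zero_transfer n C (n div 2) 0 \<longleftrightarrow>
    (\<forall>\<theta>. eigenvalue (hermitian_adj n C) \<theta> \<longrightarrow>
       card {j \<in> index_set n C \<theta>. even j} = card {j \<in> index_set n C \<theta>. odd j})"
proof -
  have index_set: "index_set n C \<theta> = {j. j \<in> {..<n} \<and> mu n C j = \<theta>}" for \<theta>
    by (auto simp: index_set_def)
  have balanced_iff: "(\<Sum>j\<in>index_set n C \<theta>. (-1) ^ j) = (0 :: complex) \<longleftrightarrow>
      card {j \<in> index_set n C \<theta>. even j} = card {j \<in> index_set n C \<theta>. odd j}" for \<theta>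
    by (subst sum_minus_one_powers) (simp_all add: index_set)
  have zero_transfer_iff: "zero_transfer n C (n div 2) 0 \<longleftrightarrow>
      (\<forall>t\<ge>0. (\<Sum>j<n. (-1) ^ j * exp (- \<i> * mu n C j * of_real t)) = 0)"
    using assms by (simp add: zero_transfer_def transition_matrix_antipodal)
  show ?thesis
  proof (intro iffI allI impI)
    fix \<theta>
    assume "zero_transfer n C (n div 2) 0"
    then have "(\<Sum>j<n. (-1) ^ j * (- \<i> * mu n C j) ^ k) = 0" for k
      unfolding zero_transfer_iff by (intro exp_sum_eq_0_imp_moments_eq_0) simp
    \<comment> \<open>Multiplication by \<open>- \<i>\<close> is injective, so this fibre is the
      index set of \<open>\<theta>\<close>.\<close>
    then have "(\<Sum>j | j \<in> {..<n} \<and> - \<i> * mu n C j = - \<i> * \<theta>. (-1) ^ j) = (0 :: complex)"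
      by (intro moments_eq_0_imp_fibre_sums_eq_0) auto
    then show "card {j \<in> index_set n C \<theta>. even j} = card {j \<in> index_set n C \<theta>. odd j}"
      unfolding balanced_iff [symmetric] by (simp add: index_set)
  next
    assume balanced: "\<forall>\<theta>. eigenvalue (hermitian_adj n C) \<theta> \<longrightarrow>
       card {j \<in> index_set n C \<theta>. even j} = card {j \<in> index_set n C \<theta>. odd j}"
    show "zero_transfer n C (n div 2) 0"
      unfolding zero_transfer_iff
    proof (intro allI impI)
      fix t :: real
      \<comment> \<open>Grouping the indices by eigenvalue makes the exponential constant on each
        group, leaving the signed count as its coefficient.\<close>
      have "(\<Sum>j<n. (-1) ^ j * exp (- \<i> * mu n C j * of_real t)) =
          (\<Sum>\<theta>\<in>mu n C ` {..<n}. \<Sum>j\<in>index_set n C \<theta>. (-1) ^ j * exp (- \<i> * mu n C j * of_real t))"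
        unfolding index_set by (rule sum.image_gen) simp
      also have "\<dots> = (\<Sum>\<theta>\<in>mu n C ` {..<n}.
          (\<Sum>j\<in>index_set n C \<theta>. (-1) ^ j) * exp (- \<i> * \<theta> * of_real t))"
        unfolding sum_distrib_right by (intro sum.cong) (auto simp: index_set)
      also have "\<dots> = 0"
        using balanced eigenvalue_mu [OF assms(1,3)]
        by (intro sum.neutral) (auto simp: balanced_iff)
      finally show "(\<Sum>j<n. (-1) ^ j * exp (- \<i> * mu n C j * of_real t)) = 0" .
    qed
  qed
qed

end
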